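(* Let $\mathcal{H}$ be a real Hilbert space and let $\mathcal{A}:\mathcal{H}\to 2^{\mathcal{H}}$, $\mathcal{Q}:\mathcal{H}\to\mathcal{H}$, $\mathcal{B}:\mathcal{H}\to\mathcal{H}$ satisfy: (1) $\mathcal{A}$ is maximally monotone; (2) $\mathcal{Q}$ is linear, bounded, self-adjoint; (3) $\mathcal{Q}$ is degenerate, i.e. positive semi-definite with $\ker\mathcal{Q}\setminus\{0\}\neq\emptyset$; (4) $\mathrm{ran}\,\mathcal{Q}$ is closed; (5) $\mathcal{B}$ is $\beta^{-1}$-cocoercive with $\beta\in[0,+\infty[$ and $\mathrm{dom}\,\mathcal{B}=\mathcal{H}$; (6) $\mathrm{ran}\,\mathcal{B}\subseteq\mathrm{ran}\,\mathcal{Q}$; (7) $\mathrm{ran}(\mathcal{A}+\mathcal{Q})\supseteq\mathrm{ran}(\mathcal{Q}-\mathcal{B})$; (8) $\mathrm{zer}(\mathcal{A}+\mathcal{B})\neq\emptyset$. Let $\nu\in\,]0,+\infty[$ be a constant with $\|\mathcal{Q}x\|\ge\nu\|x\|$ for all $x\in(\ker\mathcal{Q})^\perp=\mathrm{ran}\,\mathcal{Q}$, and let $\mathcal{T}=(\mathcal{A}+\mathcal{Q})^{-1}(\mathcal{Q}-\mathcal{B})$. If $\nu>\beta/2$, then: (i) $\mathcal{T}$ is $\mathcal{Q}$-based $\frac{2\nu}{4\nu-\beta}$-averaged. (ii) $\mathcal{T}$ is always $\mathcal{Q}$-nonexpansive, and in particular it is $\mathcal{Q}$-firmly nonexpansive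 if and only if $\beta=0$. (iii) $\mathcal{I}-\mathcal{T}$ is $\mathcal{Q}$-based $(1-\frac{\beta}{4\nu})$-cocoercive. (iv) $\mathcal{I}-\gamma(\mathcal{I}-\mathcal{T})$ is $\mathcal{Q}$-based $\frac{2\gamma\nu}{4\nu-\beta}$-averaged if $\gamma\in\,]0,2-\frac{\beta}{2\nu}[$. (v) $\mathcal{I}-\gamma(\mathcal{I}-\mathcal{T})$ is $\mathcal{Q}$-nonexpansive, and in particular $\mathcal{Q}$-firmly nonexpansive, if $\gamma\in\,]0,1-\frac{\beta}{4\nu}[$.
   Context: $\mathcal{I}$ is the identity. $\|x\|_{\mathcal{Q}}^2:=\langle\mathcal{Q}x|x\rangle$ (a seminorm when $\mathcal{Q}$ is degenerate). $\mathrm{zer}(\mathcal{A}+\mathcal{B})=\{x:0\in\mathcal{A}x+\mathcal{B}x\}$. $\mathcal{B}$ is $\beta^{-1}$-cocoercive if $\langle x_1-x_2|\mathcal{B}x_1-\mathcal{B}x_2\rangle\ge\beta^{-1}\|\mathcal{B}x_1-\mathcal{B}x_2\|^2$ for all $x_1,x_2$; by convention the case $\beta=0$ means $\mathcal{B}=0$. The operator $\mathcal{T}$ is treated as an everywhere defined operator $\mathcal{H}\to\mathcal{H}$ (condition (7) gives $\mathrm{dom}\,\mathcal{T}=\mathcal{H}$). Definitions, for an operator $\mathcal{T}$ and all $x_1,x_2\in\mathcal{H}$. $\mathcal{Q}$-nonexpansive: $\|\mathcal{T}x_1-\mathcal{T}x_2\|_{\mathcal{Q}}\le\|x_1-x_2\|_{\mathcal{Q}}$.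 $\mathcal{Q}$-firmly nonexpansive: $\langle\mathcal{Q}(x_1-x_2)|\mathcal{T}x_1-\mathcal{T}x_2\rangle\ge\|\mathcal{T}x_1-\mathcal{T}x_2\|_{\mathcal{Q}}^2$. $\mathcal{Q}$-based $\delta$-cocoercive: $\langle\mathcal{Q}(x_1-x_2)|\mathcal{T}x_1-\mathcal{T}x_2\rangle\ge\delta\|\mathcal{T}x_1-\mathcal{T}x_2\|_{\mathcal{Q}}^2$. $\mathcal{Q}$-based $\alpha$-averaged with $\alpha\in\,]0,1[$: there is a $\mathcal{Q}$-nonexpansive operator $\mathcal{K}$ with $\mathcal{T}=(1-\alpha)\mathcal{I}+\alpha\mathcal{K}$.
   Formalization: In (ii), "only if β=0" is false for a single T (H=R, Q=0, B=0, A=I, T=0, β=ν=1), so it is stated uniformly: T is Q-firmly nonexpansive for every problem on R^3 with constants β, ν if and only if β=0; "if β=0" is also stated for the given T. *)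

theory Defs
  imports "HOL-Analysis.Analysis"
begin

text \<open>A real Hilbert space is a type of sort \<open>{real_inner, complete_space}\<close>. A set-valued operator
  on it is a function \<open>'a \<Rightarrow> 'a set\<close>; everywhere defined single-valued operators are plain
  functions and enter set-valued expressions through \<open>single\<close>.\<close>

definition single :: "('a \<Rightarrow> 'b) \<Rightarrow> 'a \<Rightarrow> 'b set" where
  "single F x = {F x}"

definition op_add :: "('a \<Rightarrow> 'b::plus set) \<Rightarrow> ('a \<Rightarrow> 'b set) \<Rightarrow> 'a \<Rightarrow> 'b set" where
  "op_add A C x = {u + v | u v. u \<in> A x \<and> v \<in> C x}"

definition op_inv :: "('a \<Rightarrow> 'b set) \<Rightarrow> 'b \<Rightarrow> 'a set" where
  "op_inv A u = {x. u \<in> A x}"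

definition op_ran :: "('a \<Rightarrow> 'b set) \<Rightarrow> 'b set" where
  "op_ran A = (\<Union>x. A x)"

definition op_zer :: "('a \<Rightarrow> 'b::zero set) \<Rightarrow> 'a set" where
  "op_zer A = {x. 0 \<in> A x}"

definition monotone_op :: "('a::real_inner \<Rightarrow> 'a set) \<Rightarrow> bool" where
  "monotone_op A \<longleftrightarrow> (\<forall>x y. \<forall>u\<in>A x. \<forall>v\<in>A y. 0 \<le> inner (x - y) (u - v))"

definition maximally_monotone :: "('a::real_inner \<Rightarrow> 'a set) \<Rightarrow> bool" where
  "maximally_monotone A \<longleftrightarrow>
     monotone_op A \<and> (\<forall>C. monotone_op C \<and> (\<forall>x. A x \<subseteq> C x) \<longrightarrow> C = A)"

definition self_adjoint :: "('a::real_inner \<Rightarrow> 'a) \<Rightarrow> bool" where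
  "self_adjoint Q \<longleftrightarrow> (\<forall>x y. inner (Q x) y = inner x (Q y))"

definition ker :: "('a \<Rightarrow> 'b::zero) \<Rightarrow> 'a set" where
  "ker Q = {x. Q x = 0}"

definition degenerate :: "('a::real_inner \<Rightarrow> 'a) \<Rightarrow> bool" where
  "degenerate Q \<longleftrightarrow> (\<forall>x. 0 \<le> inner (Q x) x) \<and> ker Q - {0} \<noteq> {}"

text \<open>\<open>inverse_cocoercive \<beta> B\<close> says that \<open>B\<close> is \<open>1/\<beta>\<close>-cocoercive. The value \<open>\<beta> = 0\<close> is
  conventionally taken to mean \<open>B = 0\<close>; it has to be treated separately because \<open>1 / 0 = 0\<close> here.\<close>

definition inverse_cocoercive :: "real \<Rightarrow> ('a::real_inner \<Rightarrow> 'a) \<Rightarrow> bool" where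
  "inverse_cocoercive \<beta> B \<longleftrightarrow>
     (if \<beta> = 0 then \<forall>x. B x = 0
      else \<forall>x1 x2. inner (x1 - x2) (B x1 - B x2) \<ge> (1 / \<beta>) * (norm (B x1 - B x2))\<^sup>2)"

definition qnorm :: "('a::real_inner \<Rightarrow> 'a) \<Rightarrow> 'a \<Rightarrow> real" where
  "qnorm Q x = sqrt (inner (Q x) x)"

definition q_nonexpansive :: "('a::real_inner \<Rightarrow> 'a) \<Rightarrow> ('a \<Rightarrow> 'a) \<Rightarrow> bool" where
  "q_nonexpansive Q T \<longleftrightarrow> (\<forall>x1 x2. qnorm Q (T x1 - T x2) \<le> qnorm Q (x1 - x2))"

definition q_firmly_nonexpansive :: "('a::real_inner \<Rightarrow> 'a) \<Rightarrow> ('a \<Rightarrow> 'a) \<Rightarrow> bool" where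
  "q_firmly_nonexpansive Q T \<longleftrightarrow>
     (\<forall>x1 x2. inner (Q (x1 - x2)) (T x1 - T x2) \<ge> (qnorm Q (T x1 - T x2))\<^sup>2)"

definition q_cocoercive :: "('a::real_inner \<Rightarrow> 'a) \<Rightarrow> real \<Rightarrow> ('a \<Rightarrow> 'a) \<Rightarrow> bool" where
  "q_cocoercive Q \<delta> T \<longleftrightarrow>
     (\<forall>x1 x2. inner (Q (x1 - x2)) (T x1 - T x2) \<ge> \<delta> * (qnorm Q (T x1 - T x2))\<^sup>2)"

definition q_averaged :: "('a::real_inner \<Rightarrow> 'a) \<Rightarrow> real \<Rightarrow> ('a \<Rightarrow> 'a) \<Rightarrow> bool" where
  "q_averaged Q \<alpha> T \<longleftrightarrow> 0 < \<alpha> \<and> \<alpha> < 1 \<and>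
     (\<exists>K. q_nonexpansive Q K \<and> (\<forall>x. T x = (1 - \<alpha>) *\<^sub>R x + \<alpha> *\<^sub>R K x))"

definition fb_problem ::
  "('a::{real_inner,complete_space} \<Rightarrow> 'a set) \<Rightarrow> ('a \<Rightarrow> 'a) \<Rightarrow> ('a \<Rightarrow> 'a) \<Rightarrow> real \<Rightarrow> real \<Rightarrow> bool" where
  "fb_problem A Q B \<beta> \<nu> \<longleftrightarrow>
     maximally_monotone A \<and>
     bounded_linear Q \<and> self_adjoint Q \<and>
     degenerate Q \<and>
     closed (range Q) \<and>
     0 \<le> \<beta> \<and> inverse_cocoercive \<beta> B \<and>
     range B \<subseteq> range Q \<and>
     range (\<lambda>x. Q x - B x) \<subseteq> op_ran (op_add A (single Q)) \<and>
     op_zer (op_add A (single B)) \<noteq> {} \<and>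
     0 < \<nu> \<and> (\<forall>x \<in> orthogonal_comp (ker Q). norm (Q x) \<ge> \<nu> * norm x)"

text \<open>\<open>(A + Q)\<^sup>-\<^sup>1 (Q - B)\<close> may be multivalued, since \<open>Q\<close> is degenerate. As an everywhere defined map
  it is represented by an arbitrary selection \<open>T\<close>; if it is single-valued, \<open>T\<close> is that operator.\<close>

definition fb_operator ::
  "('a::{real_inner,complete_space} \<Rightarrow> 'a set) \<Rightarrow> ('a \<Rightarrow> 'a) \<Rightarrow> ('a \<Rightarrow> 'a) \<Rightarrow> ('a \<Rightarrow> 'a) \<Rightarrow> bool" where
  "fb_operator A Q B T \<longleftrightarrow> (\<forall>x. T x \<in> op_inv (op_add A (single Q)) (Q x - B x))"

text \<open>Firm nonexpansiveness holds for every problem with the given constants \<open>\<beta>\<close> and \<open>\<nu>\<close> on the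
  Hilbert space \<open>'a\<close>. This uniform form is what an ``only if \<open>\<beta> = 0\<close>'' claim can refer to:
  \<open>\<beta>\<close> is only a cocoercivity bound, so a single operator may be firmly nonexpansive with
  \<open>\<beta> > 0\<close> (for instance if \<open>B = 0\<close>). Failure for a given \<open>\<beta> > 0\<close> can need \<open>range Q\<close> to be
  two-dimensional, hence a space of dimension at least 3, because \<open>Q\<close> also has a kernel: if \<open>\<beta> \<le> \<nu>\<close>,
  firm nonexpansiveness is automatic for \<open>Q\<close> of rank one.\<close>

definition firmness_guaranteed :: "'a::{real_inner,complete_space} itself \<Rightarrow> real \<Rightarrow> real \<Rightarrow> bool" where
  "firmness_guaranteed _ \<beta> \<nu> \<longleftrightarrow>
     (\<forall>(A :: 'a \<Rightarrow> 'a set) Q B T.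
        fb_problem A Q B \<beta> \<nu> \<and> fb_operator A Q B T \<longrightarrow> q_firmly_nonexpansive Q T)"

end

theory Submission
  imports Defs
begin

text \<open>Let \<open>d = x1 - x2\<close>, \<open>e = T x1 - T x2\<close>, \<open>b = B x1 - B x2\<close> and \<open>w = d - e\<close>. Monotonicity of \<open>A\<close>
  gives \<open>\<langle>Q w, e\<rangle> \<ge> \<langle>b, e\<rangle> = \<langle>b, d\<rangle> - \<langle>b, w\<rangle>\<close>. Write \<open>b = Q c\<close> with \<open>c\<close> orthogonal to \<open>ker Q\<close>, so that
  \<open>\<langle>Q c, c\<rangle> \<le> \<parallel>b\<parallel>\<^sup>2 / \<nu>\<close>; completing the square in the \<open>Q\<close>-seminorm and using cocoercivity of \<open>B\<close>
  yields \<open>\<langle>b, d\<rangle> - \<langle>b, w\<rangle> \<ge> - (\<beta> / (4 \<nu>)) \<langle>Q w, w\<rangle>\<close>. This is the cocoercivity (iii) of \<open>I - T\<close>, and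
  every other positive claim is a formal consequence of it. For \<open>\<beta> > 0\<close>, firm nonexpansiveness
  fails for \<open>Q = diag(\<nu>, \<nu>, 0)\<close>, \<open>B\<close> equal to \<open>\<beta>\<close> times the projection onto the line through
  \<open>(1, 1, 0)\<close>, and \<open>A\<close> the normal cone operator of the plane \<open>x $ 2 = 0\<close>.\<close>

section \<open>Orthogonal projection onto closed subspaces\<close>

lemma closed_subspace_nearest_point:
  fixes S :: "'a::{real_inner,complete_space} set"
  assumes "subspace S" "closed S"
  obtains p where "p \<in> S" "\<And>s. s \<in> S \<Longrightarrow> norm (x - p) \<le> norm (x - s)"
proof -
  define D where "D = Inf ((\<lambda>s. (norm (x - s))\<^sup>2) ` S)"
  have ne: "S \<noteq> {}" using assms(1) subspace_0 by blast
  have bdd: "bdd_below ((\<lambda>s. (norm (x - s))\<^sup>2) ` S)" by (auto intro!: bdd_belowI[of _ 0])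
  have D_le: "D \<le> (norm (x - s))\<^sup>2" if "s \<in> S" for s
    unfolding D_def using bdd that by (auto intro: cInf_lower)
  have "\<exists>s\<in>S. (norm (x - s))\<^sup>2 < D + inverse (real (Suc n))" for n
    using cInf_lessD[of "(\<lambda>s. (norm (x - s))\<^sup>2) ` S" "D + inverse (real (Suc n))"] ne
    unfolding D_def by auto
  then obtain f where f: "\<And>n. f n \<in> S" "\<And>n. (norm (x - f n))\<^sup>2 < D + inverse (real (Suc n))"
    by metis
  \<comment> \<open>The midpoint of \<open>f m\<close> and \<open>f n\<close> stays in
    \<open>S\<close>, so its squared distance to \<open>x\<close> is at least \<open>D\<close>. The
    parallelogram law then bounds the gap by the excesses over \<open>D\<close>, which makes the
    minimizing sequence Cauchy.\<close>
  have par: "(norm (f m - f n))\<^sup>2 \<le> 2 * inverse (real (Suc m)) + 2 * inverse (real (Suc n))" for m n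
  proof -
    have "(1/2) *\<^sub>R (f m + f n) \<in> S"
      using assms(1) f(1) by (simp add: subspace_add subspace_scale)
    then have "D \<le> (norm (x - (1/2) *\<^sub>R (f m + f n)))\<^sup>2" by (rule D_le)
    moreover have "(norm (f m - f n))\<^sup>2 = 2 * (norm (x - f m))\<^sup>2 + 2 * (norm (x - f n))\<^sup>2
        - 4 * (norm (x - (1/2) *\<^sub>R (f m + f n)))\<^sup>2"
      unfolding power2_norm_eq_inner
      by (simp add: inner_diff inner_add inner_commute algebra_simps)
    ultimately show ?thesis using f(2)[of m] f(2)[of n] by linarith
  qed
  have "Cauchy f"
  proof (rule metric_CauchyI)
    fix e :: real assume e: "0 < e"
    then obtain M where M: "inverse (real (Suc M)) < e\<^sup>2 / 4"
      using reals_Archimedean[of "e\<^sup>2 / 4"] by auto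
    have "dist (f m) (f n) < e" if "m \<ge> M" "n \<ge> M" for m n
    proof -
      have "inverse (real (Suc m)) \<le> inverse (real (Suc M))"
        "inverse (real (Suc n)) \<le> inverse (real (Suc M))"
        using that by (simp_all add: le_imp_inverse_le)
      then have "(norm (f m - f n))\<^sup>2 < e\<^sup>2" using par[of m n] M by linarith
      then show ?thesis using e by (simp add: dist_norm power_less_imp_less_base)
    qed
    then show "\<exists>M. \<forall>m\<ge>M. \<forall>n\<ge>M. dist (f m) (f n) < e" by blast
  qed
  then obtain p where p: "f \<longlonglongrightarrow> p" using Cauchy_convergent convergent_def by blast
  have pS: "p \<in> S" using assms(2) f(1) p closed_sequentially by blast
  have "(\<lambda>n. (norm (x - f n))\<^sup>2) \<longlonglongrightarrow> (norm (x - p))\<^sup>2"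
    by (intro tendsto_intros p)
  moreover have "(\<lambda>n. D + inverse (real (Suc n))) \<longlonglongrightarrow> D + 0"
    by (intro tendsto_intros LIMSEQ_inverse_real_of_nat)
  ultimately have "(norm (x - p))\<^sup>2 \<le> D + 0"
    by (rule LIMSEQ_le) (use f(2) in \<open>auto intro: less_imp_le\<close>)
  then have "norm (x - p) \<le> norm (x - s)" if "s \<in> S" for s
    using D_le[OF that] by (simp add: power2_le_imp_le)
  with pS show thesis using that by blast
qed

lemma closed_subspace_orthogonal_decomposition:
  fixes S :: "'a::{real_inner,complete_space} set"
  assumes "subspace S" "closed S"
  obtains p where "p \<in> S" "x - p \<in> orthogonal_comp S"
proof -
  obtain p where p: "p \<in> S" "\<And>s. s \<in> S \<Longrightarrow> norm (x - p) \<le> norm (x - s)"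
    using closed_subspace_nearest_point[OF assms] by metis
  have "inner (x - p) s = 0" if s: "s \<in> S" for s
  proof (cases "s = 0")
    case False
    \<comment> \<open>This \<open>t\<close> minimizes the norm of
      \<open>x - p - t *\<^sub>R s\<close>. Since \<open>p\<close> is nearest, the gain
      \<open>t * inner (x - p) s\<close>, a square divided by \<open>inner s s\<close>, cannot be
      positive.\<close>
    define t where "t = inner (x - p) s / inner s s"
    have pos: "inner s s > 0" using False by simp
    have "p + t *\<^sub>R s \<in> S" using assms(1) p(1) s by (simp add: subspace_add subspace_scale)
    then have "norm (x - p) \<le> norm (x - p - t *\<^sub>R s)" using p(2) by (metis diff_diff_add)
    then have "inner (x - p) (x - p) \<le> inner (x - p - t *\<^sub>R s) (x - p - t *\<^sub>R s)"
      by (simp add: norm_le)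
    also have "\<dots> = inner (x - p) (x - p) - 2 * t * inner (x - p) s + t * (t * inner s s)"
      by (simp add: inner_diff_left[of "x - p"] inner_diff_right[of _ "x - p"] inner_commute)
    also have "t * inner s s = inner (x - p) s" using pos by (simp add: t_def)
    finally have "t * inner (x - p) s \<le> 0" by simp
    then have "(inner (x - p) s)\<^sup>2 \<le> 0"
      using pos by (simp add: t_def power2_eq_square divide_le_0_iff)
    then show ?thesis by simp
  qed simp
  then have "x - p \<in> orthogonal_comp S"
    by (simp add: orthogonal_comp_def orthogonal_def inner_commute)
  with p(1) show thesis using that by blast
qed

section \<open>The \<open>Q\<close>-seminorm and the residual \<open>x - T x\<close>\<close>

lemma qnorm_power2: "(\<And>x. 0 \<le> inner (Q x) x) \<Longrightarrow> (qnorm Q x)\<^sup>2 = inner (Q x) x"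
  by (simp add: qnorm_def)

text \<open>Removing the kernel component \<open>p\<close> of \<open>x\<close> changes neither
  \<open>Q x\<close> nor, by self-adjointness, \<open>inner (Q x) x\<close>. Cauchy-Schwarz and the
  lower bound then apply to \<open>x - p\<close>. Because \<open>x\<close> is arbitrary, any
  preimage under \<open>Q\<close> can be used later, not only one orthogonal to the kernel.\<close>

lemma inner_le_norm_power2_of_lower_bound:
  fixes Q :: "'a::{real_inner,complete_space} \<Rightarrow> 'a"
  assumes Q: "bounded_linear Q" "self_adjoint Q"
    and \<nu>: "0 < \<nu>" "\<And>x. x \<in> orthogonal_comp (ker Q) \<Longrightarrow> \<nu> * norm x \<le> norm (Q x)"
  shows "\<nu> * inner (Q x) x \<le> (norm (Q x))\<^sup>2"
proof -
  interpret Q: bounded_linear Q by fact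
  have "ker Q = Q -` {0}" by (auto simp: ker_def)
  moreover have "continuous_on UNIV Q" by (intro Q.continuous_on continuous_intros)
  ultimately have "closed (ker Q)" by (metis closed_singleton closed_vimage)
  moreover have "subspace (ker Q)"
    by (auto simp: subspace_def ker_def Q.zero Q.add Q.scaleR)
  ultimately obtain p where p: "p \<in> ker Q" "x - p \<in> orthogonal_comp (ker Q)"
    using closed_subspace_orthogonal_decomposition by metis
  have Qp: "Q p = 0" using p(1) by (simp add: ker_def)
  have eq: "Q (x - p) = Q x" by (simp add: Q.diff Qp)
  have "inner (Q x) p = inner x (Q p)" using Q(2) by (simp add: self_adjoint_def)
  then have "inner (Q x) x = inner (Q x) (x - p)" by (simp add: Qp inner_diff_right)
  also have "\<dots> \<le> norm (Q x) * norm (x - p)" by (rule norm_cauchy_schwarz)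
  finally have "\<nu> * inner (Q x) x \<le> norm (Q x) * (\<nu> * norm (x - p))"
    using \<nu>(1) by (simp add: mult.left_commute)
  also have "\<dots> \<le> norm (Q x) * norm (Q x)"
    using \<nu>(2)[OF p(2)] eq by (simp add: mult_left_mono)
  finally show ?thesis by (simp add: power2_eq_square)
qed

lemma fb_residual_cocoercive:
  assumes P: "fb_problem A Q B \<beta> \<nu>" and T: "fb_operator A Q B T"
  shows "q_cocoercive Q (1 - \<beta> / (4 * \<nu>)) (\<lambda>x. x - T x)"
  unfolding q_cocoercive_def
proof (intro allI)
  fix x1 x2
  have bl: "bounded_linear Q" and sa: "self_adjoint Q"
    and psd: "\<And>x. 0 \<le> inner (Q x) x" and mono: "monotone_op A"
    and \<beta>: "0 \<le> \<beta>" "inverse_cocoercive \<beta> B" and ran: "range B \<subseteq> range Q" and \<nu>: "0 < \<nu>"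
    and lower: "\<And>x. x \<in> orthogonal_comp (ker Q) \<Longrightarrow> \<nu> * norm x \<le> norm (Q x)"
    using P by (auto simp: fb_problem_def degenerate_def maximally_monotone_def)
  interpret Q: bounded_linear Q by fact
  have sym: "inner (Q x) y = inner (Q y) x" for x y
    using sa by (metis self_adjoint_def inner_commute)
  define d e b w where "d = x1 - x2" and "e = T x1 - T x2" and "b = B x1 - B x2" and "w = d - e"
  \<comment> \<open>This is the inclusion defining \<open>T x\<close>, solved for the element of
    \<open>A (T x)\<close>, so that monotonicity can be applied at \<open>T x1\<close> and
    \<open>T x2\<close>.\<close>
  have "Q x - B x - Q (T x) \<in> A (T x)" for x
  proof -
    have "Q x - B x \<in> op_add A (single Q) (T x)"
      using T by (simp add: fb_operator_def op_inv_def)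
    then obtain u where "u \<in> A (T x)" "Q x - B x = u + Q (T x)"
      by (auto simp: op_add_def single_def)
    then show ?thesis by simp
  qed
  then have "0 \<le> inner (T x1 - T x2) ((Q x1 - B x1 - Q (T x1)) - (Q x2 - B x2 - Q (T x2)))"
    using mono by (auto simp: monotone_op_def)
  also have "(Q x1 - B x1 - Q (T x1)) - (Q x2 - B x2 - Q (T x2)) = Q w - b"
    by (simp add: w_def d_def e_def b_def Q.diff)
  finally have m: "inner b e \<le> inner (Q w) e"
    by (simp add: e_def inner_diff_right inner_commute)
  have be: "inner b e = inner b d - inner b w" by (simp add: w_def inner_diff_right)
  have "inner b e \<ge> - (\<beta> / (4 * \<nu>)) * inner (Q w) w"
  proof (cases "\<beta> = 0")
    case True
    then show ?thesis using \<beta>(2) by (simp add: inverse_cocoercive_def b_def)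
  next
    case False
    with \<beta>(1) have pos: "0 < \<beta>" by simp
    obtain c1 c2 where c12: "B x1 = Q c1" "B x2 = Q c2" using ran by blast
    define c where "c = c1 - c2"
    have c: "b = Q c" by (simp add: c_def b_def c12 Q.diff)
    \<comment> \<open>With this \<open>k\<close>, the cross term of
      \<open>\<beta> / (4 * \<nu>)\<close> times the squared seminorm of
      \<open>w - k *\<^sub>R c\<close> is exactly \<open>- inner b w\<close>. The last term becomes
      \<open>\<nu> * inner (Q c) c / \<beta>\<close>, which cocoercivity of \<open>B\<close> bounds
      by \<open>inner b d\<close>.\<close>
    define k where "k = 2 * \<nu> / \<beta>"
    have coco: "(norm b)\<^sup>2 / \<beta> \<le> inner b d"
      using \<beta>(2) False by (simp add: inverse_cocoercive_def b_def d_def inner_commute)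
    have "\<nu> * inner (Q c) c \<le> (norm b)\<^sup>2"
      unfolding c using inner_le_norm_power2_of_lower_bound[OF bl sa \<nu> lower] .
    then have "\<nu> * inner (Q c) c / \<beta> \<le> (norm b)\<^sup>2 / \<beta>"
      using pos by (simp add: divide_right_mono)
    moreover have "0 \<le> \<beta> / (4 * \<nu>) * inner (Q (w - k *\<^sub>R c)) (w - k *\<^sub>R c)"
      using psd pos \<nu> by simp
    moreover have "inner (Q (w - k *\<^sub>R c)) (w - k *\<^sub>R c)
        = inner (Q w) w - 2 * k * inner (Q c) w + k * k * inner (Q c) c"
      by (simp add: Q.diff Q.scaleR inner_diff sym[of w c] algebra_simps)
    moreover have "\<beta> / (4 * \<nu>) * (inner (Q w) w - 2 * k * inner (Q c) w + k * k * inner (Q c) c)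
        = \<beta> / (4 * \<nu>) * inner (Q w) w - inner b w + \<nu> * inner (Q c) c / \<beta>"
      using pos \<nu> by (simp add: k_def c field_simps)
    ultimately show ?thesis using coco be by simp
  qed
  with m have "- (\<beta> / (4 * \<nu>)) * inner (Q w) w \<le> inner (Q w) e" by linarith
  \<comment> \<open>Substituting \<open>e = d - w\<close> produces the quadratic term that supplies
    the 1 in the constant \<open>1 - \<beta> / (4 * \<nu>)\<close>.\<close>
  also have "inner (Q w) e = inner (Q d) w - inner (Q w) w"
    by (simp add: w_def Q.diff inner_diff sym[of d e])
  finally have "(1 - \<beta> / (4 * \<nu>)) * inner (Q w) w \<le> inner (Q d) w"
    by (simp add: algebra_simps)
  moreover have "x1 - T x1 - (x2 - T x2) = w" by (simp add: w_def d_def e_def)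
  ultimately show "(1 - \<beta> / (4 * \<nu>)) * (qnorm Q (x1 - T x1 - (x2 - T x2)))\<^sup>2
      \<le> inner (Q (x1 - x2)) (x1 - T x1 - (x2 - T x2))"
    by (simp add: qnorm_power2[OF psd] d_def)
qed

section \<open>Relaxations of a \<open>Q\<close>-cocoercive operator\<close>

lemma relaxation_inner_expand:
  fixes Q :: "'a::real_inner \<Rightarrow> 'a"
  assumes "linear Q" "self_adjoint Q"
  shows "inner (Q (d - \<gamma> *\<^sub>R r)) (d - \<gamma> *\<^sub>R r)
    = inner (Q d) d - 2 * \<gamma> * inner (Q d) r + \<gamma>\<^sup>2 * inner (Q r) r"
proof -
  have "inner (Q r) d = inner (Q d) r"
    using assms(2) by (metis self_adjoint_def inner_commute)
  then show ?thesis
    by (simp add: linear_diff[OF assms(1)] linear_scale[OF assms(1)] inner_diff algebra_simps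
        power2_eq_square)
qed

lemma relaxation_difference:
  fixes R :: "'a::real_vector \<Rightarrow> 'a"
  shows "x1 - \<gamma> *\<^sub>R R x1 - (x2 - \<gamma> *\<^sub>R R x2) = (x1 - x2) - \<gamma> *\<^sub>R (R x1 - R x2)"
  by (simp add: algebra_simps)

text \<open>Expanding the square, cocoercivity makes the seminorm of the difference drop by at least
  \<open>\<gamma> * (2 * \<delta> - \<gamma>)\<close> times that of \<open>R x1 - R x2\<close>, all
  squared. The endpoint \<open>\<gamma> = 2 * \<delta>\<close> is included because averagedness uses
  it.\<close>

lemma q_nonexpansive_relaxation:
  fixes Q :: "'a::real_inner \<Rightarrow> 'a"
  assumes Q: "linear Q" "self_adjoint Q" "\<And>x. 0 \<le> inner (Q x) x"
    and R: "q_cocoercive Q \<delta> R" and \<gamma>: "0 \<le> \<gamma>" "\<gamma> \<le> 2 * \<delta>"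
  shows "q_nonexpansive Q (\<lambda>x. x - \<gamma> *\<^sub>R R x)"
  unfolding q_nonexpansive_def relaxation_difference
proof (intro allI)
  fix x1 x2
  let ?d = "x1 - x2" and ?r = "R x1 - R x2"
  have "\<delta> * inner (Q ?r) ?r \<le> inner (Q ?d) ?r"
    using R by (simp add: q_cocoercive_def qnorm_power2[OF Q(3)])
  then have "2 * \<gamma> * (\<delta> * inner (Q ?r) ?r) \<le> 2 * \<gamma> * inner (Q ?d) ?r"
    using \<gamma>(1) by (simp add: mult_left_mono)
  moreover have "\<gamma> * (\<gamma> * inner (Q ?r) ?r) \<le> \<gamma> * (2 * \<delta> * inner (Q ?r) ?r)"
    using \<gamma> Q(3) by (intro mult_left_mono mult_right_mono) auto
  ultimately have "inner (Q (?d - \<gamma> *\<^sub>R ?r)) (?d - \<gamma> *\<^sub>R ?r) \<le> inner (Q ?d) ?d"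
    unfolding relaxation_inner_expand[OF Q(1,2)] by (simp add: power2_eq_square mult.assoc mult.left_commute)
  then show "qnorm Q (?d - \<gamma> *\<^sub>R ?r) \<le> qnorm Q ?d" by (simp add: qnorm_def)
qed

text \<open>After expansion and cancellation, firmness says that
  \<open>\<gamma>\<^sup>2 * inner (Q r) r\<close> is at most
  \<open>\<gamma> * inner (Q d) r\<close>, where \<open>d\<close> and \<open>r\<close> are the
  differences of the points and of their images under \<open>R\<close>. This is cocoercivity
  weakened from \<open>\<delta>\<close> to \<open>\<gamma>\<close>.\<close>

lemma q_firmly_nonexpansive_relaxation:
  fixes Q :: "'a::real_inner \<Rightarrow> 'a"
  assumes Q: "linear Q" "self_adjoint Q" "\<And>x. 0 \<le> inner (Q x) x"
    and R: "q_cocoercive Q \<delta> R" and \<gamma>: "0 \<le> \<gamma>" "\<gamma> \<le> \<delta>"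
  shows "q_firmly_nonexpansive Q (\<lambda>x. x - \<gamma> *\<^sub>R R x)"
  unfolding q_firmly_nonexpansive_def relaxation_difference qnorm_power2[OF Q(3)]
proof (intro allI)
  fix x1 x2
  let ?d = "x1 - x2" and ?r = "R x1 - R x2"
  have "\<gamma> * inner (Q ?r) ?r \<le> \<delta> * inner (Q ?r) ?r"
    using \<gamma> Q(3) by (intro mult_right_mono) auto
  also have "\<dots> \<le> inner (Q ?d) ?r"
    using R by (simp add: q_cocoercive_def qnorm_power2[OF Q(3)])
  finally have "\<gamma> * (\<gamma> * inner (Q ?r) ?r) \<le> \<gamma> * inner (Q ?d) ?r"
    using \<gamma>(1) by (simp add: mult_left_mono)
  then show "inner (Q (?d - \<gamma> *\<^sub>R ?r)) (?d - \<gamma> *\<^sub>R ?r) \<le> inner (Q ?d) (?d - \<gamma> *\<^sub>R ?r)"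
    unfolding relaxation_inner_expand[OF Q(1,2)]
    by (simp add: power2_eq_square inner_diff_right mult.assoc)
qed

lemma q_averaged_relaxation:
  fixes Q :: "'a::real_inner \<Rightarrow> 'a"
  assumes Q: "linear Q" "self_adjoint Q" "\<And>x. 0 \<le> inner (Q x) x"
    and R: "q_cocoercive Q \<delta> R" and \<gamma>: "0 < \<gamma>" "\<gamma> < 2 * \<delta>"
  shows "q_averaged Q (\<gamma> / (2 * \<delta>)) (\<lambda>x. x - \<gamma> *\<^sub>R R x)"
  unfolding q_averaged_def
\<comment> \<open>The witness is the extreme relaxation, with parameter \<open>2 * \<delta>\<close>.
  Smaller parameters are convex combinations of it with the identity.\<close>
proof (intro conjI exI[of _ "\<lambda>x. x - (2 * \<delta>) *\<^sub>R R x"] allI)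
  have \<delta>: "0 < \<delta>" using \<gamma> by simp
  show "0 < \<gamma> / (2 * \<delta>)" "\<gamma> / (2 * \<delta>) < 1" using \<gamma> \<delta> by simp_all
  show "q_nonexpansive Q (\<lambda>x. x - (2 * \<delta>) *\<^sub>R R x)"
    using q_nonexpansive_relaxation[OF Q R] \<delta> by simp
  show "x - \<gamma> *\<^sub>R R x
      = (1 - \<gamma> / (2 * \<delta>)) *\<^sub>R x + (\<gamma> / (2 * \<delta>)) *\<^sub>R (x - (2 * \<delta>) *\<^sub>R R x)" for x
    using \<delta> by (simp add: scaleR_diff_left scaleR_diff_right)
qed

section \<open>Firm nonexpansiveness of \<open>T\<close>, and its failure for positive
  \<open>\<beta>\<close>\<close>

lemma fb_operator_firmly_nonexpansive:
  assumes "fb_problem A Q B 0 \<nu>" "fb_operator A Q B T"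
  shows "q_firmly_nonexpansive Q T"
proof -
  have Q: "linear Q" "self_adjoint Q" "\<And>x. 0 \<le> inner (Q x) x"
    using assms(1) by (auto simp: fb_problem_def degenerate_def bounded_linear.linear)
  show ?thesis
    \<comment> \<open>Here \<open>\<delta> = 1\<close>, and \<open>T\<close> is the relaxation of
      its own residual with \<open>\<gamma> = 1\<close>.\<close>
    using q_firmly_nonexpansive_relaxation[OF Q fb_residual_cocoercive[OF assms], of 1] by simp
qed

lemma maximally_monotone_normal_cone_plane:
  "maximally_monotone (\<lambda>u::real^3. {v. u $ 2 = 0 \<and> v $ 1 = 0 \<and> v $ 3 = 0})"
    (is "maximally_monotone ?A")
  unfolding maximally_monotone_def
proof (intro conjI allI impI)
  show "monotone_op ?A"
    by (auto simp: monotone_op_def inner_vec_def sum_3)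
  fix C :: "real^3 \<Rightarrow> (real^3) set"
  assume C: "monotone_op C \<and> (\<forall>x. ?A x \<subseteq> C x)"
  have "w \<in> ?A y" if w: "w \<in> C y" for y w
  proof -
    have ineq: "0 \<le> inner (y - u) (w - v)" if "v \<in> ?A u" for u v
      using C w that unfolding monotone_op_def by blast
    have "0 \<le> (y $ 1 - p) * w $ 1 + y $ 2 * (w $ 2 - q) + (y $ 3 - r) * w $ 3" for p q r
      using ineq[of "vector [0, q, 0]" "vector [p, 0, r]"] by (simp add: inner_vec_def sum_3)
    \<comment> \<open>The free coordinates \<open>p\<close>, \<open>q\<close>, \<open>r\<close> of
      the test pair are chosen so that each product becomes minus a square.\<close>
    from this[of "y $ 1 + w $ 1" "w $ 2 + y $ 2" "y $ 3 + w $ 3"]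
    have "w $ 1 * w $ 1 + y $ 2 * y $ 2 + w $ 3 * w $ 3 \<le> 0" by simp
    then have "w $ 1 = 0" "y $ 2 = 0" "w $ 3 = 0"
      using zero_le_square[of "w $ 1"] zero_le_square[of "y $ 2"] zero_le_square[of "w $ 3"]
      by (smt (verit) mult_eq_0_iff)+
    then show ?thesis by simp
  qed
  then show "C = ?A" using C by blast
qed

lemma not_firmness_guaranteed:
  assumes \<beta>: "0 < \<beta>" and \<nu>: "0 < \<nu>"
  shows "\<not> firmness_guaranteed TYPE(real^3) \<beta> \<nu>"
proof
  assume firm: "firmness_guaranteed TYPE(real^3) \<beta> \<nu>"
  define A :: "real^3 \<Rightarrow> (real^3) set"
    where "A = (\<lambda>u. {v. u $ 2 = 0 \<and> v $ 1 = 0 \<and> v $ 3 = 0})"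
  define Q :: "real^3 \<Rightarrow> real^3" where "Q = (\<lambda>x. vector [\<nu> * x $ 1, \<nu> * x $ 2, 0])"
  define B :: "real^3 \<Rightarrow> real^3"
    where "B = (\<lambda>x. vector [\<beta> / 2 * (x $ 1 + x $ 2), \<beta> / 2 * (x $ 1 + x $ 2), 0])"
  \<comment> \<open>\<open>A\<close> is nonempty only where the second coordinate is 0, and its
    values there are the whole second axis. So the first coordinate of the inclusion determines that
    of \<open>T x\<close>. The third is free, being in the kernel of \<open>Q\<close>, and is set to
    0.\<close>
  define T :: "real^3 \<Rightarrow> real^3" where "T = (\<lambda>x. vector [x $ 1 - B x $ 1 / \<nu>, 0, 0])"
  have Q_nth [simp]: "Q x $ 1 = \<nu> * x $ 1" "Q x $ 2 = \<nu> * x $ 2" "Q x $ 3 = 0" for x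
    by (simp_all add: Q_def)
  have B_nth [simp]: "B x $ 1 = \<beta> / 2 * (x $ 1 + x $ 2)" "B x $ 2 = \<beta> / 2 * (x $ 1 + x $ 2)"
    "B x $ 3 = 0" for x
    by (simp_all add: B_def)
  have inner3: "inner x y = x $ 1 * y $ 1 + x $ 2 * y $ 2 + x $ 3 * y $ 3" for x y :: "real^3"
    by (simp add: inner_vec_def sum_3)
  have "linear Q"
    by (rule linearI) (simp_all add: vec_eq_iff forall_3 algebra_simps)
  have T: "fb_operator A Q B T"
    unfolding fb_operator_def op_inv_def op_add_def single_def
  proof (intro allI CollectI exI conjI)
    fix x
    show "Q x - B x = (Q x - B x - Q (T x)) + Q (T x)" by simp
    show "Q x - B x - Q (T x) \<in> A (T x)" using \<nu> by (simp add: A_def T_def right_diff_distrib)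
  qed simp
  have "fb_problem A Q B \<beta> \<nu>"
    unfolding fb_problem_def
  proof (intro conjI ballI)
    show "maximally_monotone A" unfolding A_def by (rule maximally_monotone_normal_cone_plane)
    show "bounded_linear Q" using \<open>linear Q\<close> by (simp add: linear_conv_bounded_linear)
    show "self_adjoint Q" by (simp add: self_adjoint_def inner3)
    have "vector [0, 0, 1] \<in> ker Q" by (simp add: ker_def vec_eq_iff forall_3)
    moreover have "vector [0, 0, 1] \<noteq> (0::real^3)" by (simp add: vec_eq_iff forall_3)
    ultimately show "degenerate Q"
      unfolding degenerate_def using \<nu> by (auto simp: inner3 mult.assoc)
    show "closed (range Q)"
      using \<open>linear Q\<close> by (intro closed_subspace linear_subspace_image) auto
    show "0 \<le> \<beta>" "0 < \<nu>" using assms by auto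
    show "inverse_cocoercive \<beta> B"
      using \<beta> by (simp add: inverse_cocoercive_def power2_norm_eq_inner inner3 field_simps)
    show "range B \<subseteq> range Q"
    proof (intro image_subsetI)
      fix x
      have "B x = Q ((1 / \<nu>) *\<^sub>R B x)" using \<nu> by (simp add: vec_eq_iff forall_3)
      then show "B x \<in> range Q" by blast
    qed
    show "range (\<lambda>x. Q x - B x) \<subseteq> op_ran (op_add A (single Q))"
      using T by (auto simp: fb_operator_def op_inv_def op_ran_def)
    have "0 \<in> A 0" "B 0 = 0" by (simp_all add: A_def vec_eq_iff forall_3)
    then show "op_zer (op_add A (single B)) \<noteq> {}"
      by (force simp: op_zer_def op_add_def single_def)
    \<comment> \<open>Orthogonality to the kernel vector \<open>vector [0, 0, 1]\<close> removes the
      third coordinate, and \<open>Q\<close> acts on the rest as multiplication by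
      \<open>\<nu>\<close>.\<close>
    fix x assume "x \<in> orthogonal_comp (ker Q)"
    then have "inner (vector [0, 0, 1]) x = 0"
      using \<open>vector [0, 0, 1] \<in> ker Q\<close> by (simp add: orthogonal_comp_def orthogonal_def)
    then have "Q x = \<nu> *\<^sub>R x" by (simp add: vec_eq_iff forall_3 inner3)
    then show "\<nu> * norm x \<le> norm (Q x)" using \<nu> by simp
  qed
  with T firm have "q_firmly_nonexpansive Q T" by (auto simp: firmness_guaranteed_def)
  moreover have psd: "0 \<le> inner (Q x) x" for x using \<nu> by (simp add: inner3 mult.assoc)
  \<comment> \<open>At \<open>vector [-1, 3, 0]\<close> the first coordinate is negative while the
    sum of the first two is positive, so subtracting \<open>B\<close> pushes the first coordinate
    away from 0, to \<open>- (1 + \<beta> / \<nu>)\<close>. Firmness against the point 0 would force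
    \<open>1 + \<beta> / \<nu>\<close> to be at most 1.\<close>
  ultimately have "inner (Q (T (vector [-1, 3, 0]) - T 0)) (T (vector [-1, 3, 0]) - T 0)
      \<le> inner (Q (vector [-1, 3, 0] - 0)) (T (vector [-1, 3, 0]) - T 0)"
    unfolding q_firmly_nonexpansive_def qnorm_power2[OF psd] by blast
  then have "\<nu> * (1 + \<beta> / \<nu>) * (1 + \<beta> / \<nu>) \<le> \<nu> * (1 + \<beta> / \<nu>) * 1"
    by (simp add: inner3 T_def algebra_simps)
  moreover have "0 < \<nu> * (1 + \<beta> / \<nu>)" "0 < \<beta> / \<nu>" using \<beta> \<nu> by (simp_all add: add_pos_pos)
  ultimately show False by (simp only: mult_le_cancel_left_pos)
qed

theorem theorem2p4:
  fixes A :: "'a::{real_inner,complete_space} \<Rightarrow> 'a set"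
    and Q B T :: "'a \<Rightarrow> 'a"
    and \<beta> \<nu> :: real
  assumes "fb_problem A Q B \<beta> \<nu>"
    and "fb_operator A Q B T"
    and "\<nu> > \<beta> / 2"
  shows "q_averaged Q (2 * \<nu> / (4 * \<nu> - \<beta>)) T
    \<and> (q_nonexpansive Q T
        \<and> (\<beta> = 0 \<longrightarrow> q_firmly_nonexpansive Q T)
        \<and> (firmness_guaranteed TYPE(real^3) \<beta> \<nu> \<longleftrightarrow> \<beta> = 0))
    \<and> q_cocoercive Q (1 - \<beta> / (4 * \<nu>)) (\<lambda>x. x - T x)
    \<and> (\<forall>\<gamma>. 0 < \<gamma> \<and> \<gamma> < 2 - \<beta> / (2 * \<nu>) \<longrightarrow>
          q_averaged Q (2 * \<gamma> * \<nu> / (4 * \<nu> - \<beta>)) (\<lambda>x. x - \<gamma> *\<^sub>R (x - T x)))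
    \<and> (\<forall>\<gamma>. 0 < \<gamma> \<and> \<gamma> < 1 - \<beta> / (4 * \<nu>) \<longrightarrow>
          q_nonexpansive Q (\<lambda>x. x - \<gamma> *\<^sub>R (x - T x))
          \<and> q_firmly_nonexpansive Q (\<lambda>x. x - \<gamma> *\<^sub>R (x - T x)))"
proof -
  have Q: "linear Q" "self_adjoint Q" "\<And>x. 0 \<le> inner (Q x) x"
    and \<beta>: "0 \<le> \<beta>" and \<nu>: "0 < \<nu>"
    using assms(1) by (auto simp: fb_problem_def degenerate_def bounded_linear.linear)
  define \<delta> where "\<delta> = 1 - \<beta> / (4 * \<nu>)"
  have R: "q_cocoercive Q \<delta> (\<lambda>x. x - T x)"
    unfolding \<delta>_def by (rule fb_residual_cocoercive[OF assms(1,2)])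
  \<comment> \<open>The assumption \<open>\<nu> > \<beta> / 2\<close> says exactly that
    \<open>\<gamma> = 1\<close>, the relaxation equal to \<open>T\<close>, lies strictly inside the
    admissible range.\<close>
  have \<delta>: "1 < 2 * \<delta>" "2 * \<delta> = 2 - \<beta> / (2 * \<nu>)"
    using assms(3) \<nu> by (simp_all add: \<delta>_def field_simps)
  have \<alpha>: "\<gamma> / (2 * \<delta>) = 2 * \<gamma> * \<nu> / (4 * \<nu> - \<beta>)" for \<gamma>
    using assms(3) \<beta> \<nu> by (simp add: \<delta>_def field_simps)
  have avg: "q_averaged Q (2 * \<gamma> * \<nu> / (4 * \<nu> - \<beta>)) (\<lambda>x. x - \<gamma> *\<^sub>R (x - T x))"
    if "0 < \<gamma>" "\<gamma> < 2 - \<beta> / (2 * \<nu>)" for \<gamma>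
    using q_averaged_relaxation[OF Q R that(1)] that(2) \<delta>(2) \<alpha> by simp
  have "q_averaged Q (2 * \<nu> / (4 * \<nu> - \<beta>)) T"
    using avg[of 1] \<delta> by simp
  moreover have "q_nonexpansive Q T"
    using q_nonexpansive_relaxation[OF Q R, of 1] \<delta>(1) by simp
  moreover have "\<beta> = 0 \<longrightarrow> q_firmly_nonexpansive Q T"
    using fb_operator_firmly_nonexpansive assms(1,2) by blast
  \<comment> \<open>The \<open>\<beta> = 0\<close> direction applies the general lemma on
    \<open>real^3\<close>; the other is the counterexample with the given constants.\<close>
  moreover have "firmness_guaranteed TYPE(real^3) \<beta> \<nu> \<longleftrightarrow> \<beta> = 0"
    using not_firmness_guaranteed[of \<beta> \<nu>] \<beta> \<nu> fb_operator_firmly_nonexpansive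
    by (fastforce simp: firmness_guaranteed_def)
  moreover have "q_nonexpansive Q (\<lambda>x. x - \<gamma> *\<^sub>R (x - T x))
      \<and> q_firmly_nonexpansive Q (\<lambda>x. x - \<gamma> *\<^sub>R (x - T x))"
    if "0 < \<gamma>" "\<gamma> < 1 - \<beta> / (4 * \<nu>)" for \<gamma>
    using q_nonexpansive_relaxation[OF Q R, of \<gamma>] q_firmly_nonexpansive_relaxation[OF Q R, of \<gamma>]
      that \<delta>(1) by (simp add: \<delta>_def)
  ultimately show ?thesis using avg R unfolding \<delta>_def by blast
qed

end
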